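(* Let $A\subseteq\mathbb{N}$ be an r.e. set and let $P\subseteq\mathbb{N}$ be a set of PA degree such that $P\not\ge_{\mathrm{T}}A$. Then $P\oplus A\ge_{\mathrm{T}}\emptyset'$.
   Context: A set is of PA degree if it is Turing equivalent to a set coding a complete (consistent) extension of Peano arithmetic; equivalently, if it computes a path through (i.e. a member of) every non-empty $\Pi^0_1$ class in $2^\omega$. $\emptyset'$ is the halting problem, $\oplus$ is the recursive join, and $\ge_{\mathrm{T}}$ is Turing reducibility. *)

theory Defs
  imports Main "HOL-Library.Nat_Bijection" "HOL-Library.Sublist"
begin

section \<open>Partial recursive functions relative to a set\<close>

text \<open>
  Kleene's relativized partial recursive functions, in the unary presentation: functions of
  several arguments are functions of one argument that is a code \<^term>\<open>prod_encode (a, b)\<close>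
  of a pair. \<open>Query\<close> is the characteristic function of the set to which everything is relativized.
\<close>

datatype prog =
    Zero | Succ | Proj1 | Proj2 | Query
  | Both prog prog
  | Comp prog prog
  | Prec prog prog
  | Mu prog

text \<open>
  \<open>computes X p x y\<close>: program \<open>p\<close>, given the set \<open>X\<close>, halts on input \<open>x\<close> with output \<open>y\<close>.
  In the rule \<open>Mu\<close> the values of \<open>p\<close> at all arguments below \<open>n\<close> must be defined and nonzero.
\<close>

inductive computes :: "nat set \<Rightarrow> prog \<Rightarrow> nat \<Rightarrow> nat \<Rightarrow> bool" for X :: "nat set" where
  Zero: "computes X Zero x 0"
| Succ: "computes X Succ x (Suc x)"
| Proj1: "computes X Proj1 x (fst (prod_decode x))"
| Proj2: "computes X Proj2 x (snd (prod_decode x))"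
| Query: "computes X Query x (if x \<in> X then 1 else 0)"
| Both: "computes X p x y \<Longrightarrow> computes X q x z \<Longrightarrow> computes X (Both p q) x (prod_encode (y, z))"
| Comp: "computes X q x y \<Longrightarrow> computes X p y z \<Longrightarrow> computes X (Comp p q) x z"
| Prec_0: "computes X p a y \<Longrightarrow> computes X (Prec p q) (prod_encode (a, 0)) y"
| Prec_Suc: "computes X (Prec p q) (prod_encode (a, n)) y \<Longrightarrow>
    computes X q (prod_encode (a, prod_encode (n, y))) z \<Longrightarrow>
    computes X (Prec p q) (prod_encode (a, Suc n)) z"
| Mu: "computes X p (prod_encode (a, n)) 0 \<Longrightarrow>
    (\<And>m. m < n \<Longrightarrow> \<exists>y. computes X p (prod_encode (a, m)) (Suc y)) \<Longrightarrow>
    computes X (Mu p) a n"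

inductive_cases computes_elims:
  "computes X Zero x y"
  "computes X Succ x y"
  "computes X Proj1 x y"
  "computes X Proj2 x y"
  "computes X Query x y"
  "computes X (Both p q) x y"
  "computes X (Comp p q) x y"
  "computes X (Prec p q) x y"
  "computes X (Mu p) x y"

lemma computes_deterministic:
  "computes X p x y \<Longrightarrow> computes X p x y' \<Longrightarrow> y' = y"
proof (induction arbitrary: y' rule: computes.induct)
  case (Both p x y q z)
  from Both.prems obtain y0 z0 where
    "y' = prod_encode (y0, z0)" "computes X p x y0" "computes X q x z0"
    by (rule computes_elims(6))
  with Both.IH show ?case by blast
next
  case (Comp q x y p z)
  from Comp.prems obtain y0 where "computes X q x y0" "computes X p y0 y'"
    by (rule computes_elims(7))
  with Comp.IH show ?case by blast
next
  case (Prec_0 p a y q)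
  from Prec_0.prems have "computes X p a y'"
    by (rule computes_elims(8)) simp_all
  with Prec_0.IH show ?case by blast
next
  case (Prec_Suc p q a n y z)
  from Prec_Suc.prems obtain y0 where
    "computes X (Prec p q) (prod_encode (a, n)) y0"
    "computes X q (prod_encode (a, prod_encode (n, y0))) y'"
    by (rule computes_elims(8)) auto
  with Prec_Suc.IH show ?case by blast
next
  case (Mu p a n)
  from Mu.prems have zero: "computes X p (prod_encode (a, y')) 0"
    and below: "\<And>m. m < y' \<Longrightarrow> \<exists>z. computes X p (prod_encode (a, m)) (Suc z)"
    by (blast elim: computes_elims(9))+
  have "\<not> n < y'"
    using Mu.IH(1) below by (metis Zero_not_Suc)
  moreover have "\<not> y' < n"
    using Mu.IH(2) zero by (metis Zero_not_Suc)
  ultimately show ?case by simp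
qed (auto elim: computes_elims(1-5))

section \<open>Turing reducibility, r.e. sets and the halting problem\<close>

definition turing_reducible :: "nat set \<Rightarrow> nat set \<Rightarrow> bool"  (infix \<open>\<le>\<^sub>T\<close> 50) where
  "A \<le>\<^sub>T B \<longleftrightarrow> (\<exists>p. \<forall>x. computes B p x (if x \<in> A then 1 else 0))"

definition computable :: "nat set \<Rightarrow> bool" where
  "computable A \<longleftrightarrow> A \<le>\<^sub>T {}"

definition recursively_enumerable :: "nat set \<Rightarrow> bool" where
  "recursively_enumerable A \<longleftrightarrow> (\<exists>p. A = {x. \<exists>y. computes {} p x y})"

definition recursive_join :: "nat set \<Rightarrow> nat set \<Rightarrow> nat set" where
  "recursive_join A B = {2 * n |n. n \<in> A} \<union> {2 * n + 1 |n. n \<in> B}"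

text \<open>An effective bijective numbering of the programs.\<close>

primrec prog_code :: "prog \<Rightarrow> nat" where
  "prog_code Zero = 0"
| "prog_code Succ = 1"
| "prog_code Proj1 = 2"
| "prog_code Proj2 = 3"
| "prog_code Query = 4"
| "prog_code (Both p q) = 4 * prod_encode (prog_code p, prog_code q) + 5"
| "prog_code (Comp p q) = 4 * prod_encode (prog_code p, prog_code q) + 6"
| "prog_code (Prec p q) = 4 * prod_encode (prog_code p, prog_code q) + 7"
| "prog_code (Mu p) = 4 * prog_code p + 8"

lemma prog_code_neq:
  "4 * a + 5 \<noteq> 4 * b + 6" "4 * a + 5 \<noteq> 4 * b + 7" "4 * a + 5 \<noteq> 4 * b + 8"
  "4 * a + 6 \<noteq> 4 * b + 7" "4 * a + 6 \<noteq> 4 * b + 8" "4 * a + 7 \<noteq> 4 * b + 8" for a b :: nat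
  by presburger+

lemma inj_prog_code: "prog_code p = prog_code q \<Longrightarrow> p = q"
proof (induction p arbitrary: q)
  case (Both p1 p2)
  from Both.prems obtain q1 q2 where "q = Both q1 q2"
    "prog_code p1 = prog_code q1" "prog_code p2 = prog_code q2"
    by (cases q) (simp_all only: prog_code.simps prog_code_neq prog_code_neq[symmetric], auto)
  with Both.IH show ?case by blast
next
  case (Comp p1 p2)
  from Comp.prems obtain q1 q2 where "q = Comp q1 q2"
    "prog_code p1 = prog_code q1" "prog_code p2 = prog_code q2"
    by (cases q) (simp_all only: prog_code.simps prog_code_neq prog_code_neq[symmetric], auto)
  with Comp.IH show ?case by blast
next
  case (Prec p1 p2)
  from Prec.prems obtain q1 q2 where "q = Prec q1 q2"
    "prog_code p1 = prog_code q1" "prog_code p2 = prog_code q2"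
    by (cases q) (simp_all only: prog_code.simps prog_code_neq prog_code_neq[symmetric], auto)
  with Prec.IH show ?case by blast
next
  case (Mu p)
  from Mu.prems obtain q1 where "q = Mu q1" "prog_code p = prog_code q1"
    by (cases q) (simp_all add: prog_code_neq prog_code_neq[symmetric] del: One_nat_def)
  with Mu.IH show ?case by blast
next
  case Zero then show ?case by (cases q) simp_all
next
  case Succ then show ?case by (cases q) simp_all
next
  case Proj1 then show ?case by (cases q) simp_all
next
  case Proj2 then show ?case by (cases q) simp_all
next
  case Query then show ?case by (cases q) simp_all
qed

lemma surj_prog_code: "\<exists>p. prog_code p = e"
proof (induction e rule: less_induct)
  case (less e)
  show ?case
  proof (cases "e < 5")
    case True
    then have "e = 0 \<or> e = 1 \<or> e = 2 \<or> e = 3 \<or> e = 4" by auto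
    then show ?thesis
      using prog_code.simps(1-5) by metis
  next
    case False
    define k where "k = (e - 5) div 4"
    from False have e: "e = 4 * k + 5 \<or> e = 4 * k + 6 \<or> e = 4 * k + 7 \<or> e = 4 * k + 8"
      unfolding k_def by presburger
    obtain a b where k: "k = prod_encode (a, b)"
      by (metis prod_decode_inverse surj_pair)
    have "a < e" "b < e" "k < e"
      using e le_prod_encode_1[of a b] le_prod_encode_2[of b a] k by linarith+
    then obtain p q r where "prog_code p = a" "prog_code q = b" "prog_code r = k"
      using less.IH by metis
    then show ?thesis
      using e k prog_code.simps(6-9) by metis
  qed
qed

lemma bij_prog_code: "bij prog_code"
  using inj_prog_code surj_prog_code by (metis bijI injI surjI)

text \<open>
  The \<open>e\<close>-th program is \<open>inv prog_code e\<close>, so \<open>turing_jump {}\<close> is the set of those \<open>e\<close> such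
  that the \<open>e\<close>-th partial recursive function is defined at \<open>e\<close>.
\<close>

definition turing_jump :: "nat set \<Rightarrow> nat set" where
  "turing_jump X = {e. \<exists>y. computes X (inv prog_code e) e y}"

definition halting_problem :: "nat set" where
  "halting_problem = turing_jump {}"

section \<open>$\Pi^0_1$ classes and PA degrees\<close>

text \<open>
  A point of Cantor space is identified with the set of natural numbers of which it is the
  characteristic function.
\<close>

definition initial_segment :: "nat set \<Rightarrow> nat \<Rightarrow> bool list" where
  "initial_segment X n = map (\<lambda>i. i \<in> X) [0..<n]"

definition string_code :: "bool list \<Rightarrow> nat" where
  "string_code s = list_encode (map of_bool s)"

definition binary_tree :: "bool list set \<Rightarrow> bool" where
  "binary_tree T \<longleftrightarrow> (\<forall>s\<in>T. \<forall>t. prefix t s \<longrightarrow> t \<in> T)"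

definition paths :: "bool list set \<Rightarrow> nat set set" where
  "paths T = {X. \<forall>n. initial_segment X n \<in> T}"

definition pi01_class :: "nat set set \<Rightarrow> bool" where
  "pi01_class C \<longleftrightarrow> (\<exists>T. binary_tree T \<and> computable (string_code ` T) \<and> C = paths T)"

text \<open>
  A set has PA degree if it computes a member of every nonempty $\Pi^0_1$ class; by theorems of
  Scott, Jockusch and Soare, and Solovay these are exactly the sets Turing equivalent
  to a set coding a complete consistent extension of Peano arithmetic.
\<close>

definition PA_degree :: "nat set \<Rightarrow> bool" where
  "PA_degree P \<longleftrightarrow> (\<forall>C. pi01_class C \<and> C \<noteq> {} \<longrightarrow> (\<exists>X\<in>C. X \<le>\<^sub>T P))"

end

theory Submission
  imports Defs
begin

text \<open>
  Fix recursive enumerations of \<open>A\<close> and of the halting problem \<open>K\<close>. For a pair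
  \<open>(e, n)\<close> two events may happen: \<open>n\<close> enters \<open>A\<close> strictly before \<open>e\<close> enters \<open>K\<close>, or
  \<open>e\<close> enters \<open>K\<close> strictly before \<open>n\<close> enters \<open>A\<close>. Each is an r.e. condition on the pair
  and they exclude each other, so some \<open>X \<le>\<^sub>T P\<close> contains all the pairs of the first kind
  and none of the second (\<open>PA_degree_separates\<close>).

  Fix \<open>e\<close> and compare the section \<open>{n. (e, n) \<in> X}\<close> with \<open>A\<close>. The two differ somewhere, for
  otherwise \<open>A \<le>\<^sub>T P\<close>. A number \<open>n\<close> where they differ decides whether \<open>e \<in> K\<close>:
  if \<open>n \<in> A\<close> and \<open>(e, n) \<notin> X\<close>, then \<open>e\<close> must have entered \<open>K\<close>, since otherwise \<open>n\<close> came first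
  and \<open>(e, n)\<close> would be in \<open>X\<close>; if \<open>n \<notin> A\<close> and \<open>(e, n) \<in> X\<close>, then \<open>e \<notin> K\<close>, since otherwise \<open>e\<close>
  came first and \<open>(e, n)\<close> would be outside \<open>X\<close>. So \<open>e \<in> K\<close> if and only if \<open>n \<in> A\<close>,
  and the least such \<open>n\<close> is found by a search recursive in \<open>P \<oplus> A\<close>.

  The argument needs enumerations with a decidable stage relation that is uniform in the index.
  It comes from a universal abstract machine whose single step is a recursive function
  of coded configurations: \<open>halts_by p x s\<close> says that \<open>p\<close> halts on \<open>x\<close> within \<open>s\<close> steps
  (\<open>ex_halts_by_iff\<close>, \<open>decidable_in_halts_by\<close>). The closure properties of the functions
  recursive in a set are collected as introduction rules, so that recursiveness of an explicitly
  written function is proved by decomposing its body.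
\<close>

section \<open>Functions and predicates recursive in a set\<close>

abbreviation pr1 :: "nat \<Rightarrow> nat" where
  "pr1 z \<equiv> fst (prod_decode z)"

abbreviation pr2 :: "nat \<Rightarrow> nat" where
  "pr2 z \<equiv> snd (prod_decode z)"

definition recursive_in :: "nat set \<Rightarrow> (nat \<Rightarrow> nat) \<Rightarrow> bool" where
  "recursive_in B f \<longleftrightarrow> (\<exists>p. \<forall>x. computes B p x (f x))"

definition decidable_in :: "nat set \<Rightarrow> (nat \<Rightarrow> bool) \<Rightarrow> bool" where
  "decidable_in B P \<longleftrightarrow> recursive_in B (\<lambda>x. if P x then 1 else 0)"

lemma turing_reducible_iff_decidable_in: "A \<le>\<^sub>T B \<longleftrightarrow> decidable_in B (\<lambda>x. x \<in> A)"
  by (simp add: turing_reducible_def decidable_in_def recursive_in_def)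

text \<open>
  The conclusion of each rule in the collection is about a composite \<open>\<lambda>x. F (f x) (g x)\<close>, not about
  the bare operation \<open>F\<close>. In this form backward resolution takes a function apart from the outside,
  and operations with several arguments appear in their usual curried form.
\<close>

named_theorems recursive_intros

lemma recursive_in_const [recursive_intros]: "recursive_in B (\<lambda>x. c)"
proof (induction c)
  case 0
  then show ?case unfolding recursive_in_def by (blast intro: computes.Zero)
next
  case (Suc c)
  then show ?case unfolding recursive_in_def by (blast intro: computes.Succ computes.Comp)
qed

lemma recursive_in_id [recursive_intros]: "recursive_in B (\<lambda>x. x)"
proof -
  have "computes B (Both Proj1 Proj2) x x" for x
    using computes.Both[OF computes.Proj1 computes.Proj2, of B x] by simp
  then show ?thesis unfolding recursive_in_def by blast
qed

lemma recursive_in_comp: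
  "recursive_in B g \<Longrightarrow> recursive_in B f \<Longrightarrow> recursive_in B (\<lambda>x. g (f x))"
  unfolding recursive_in_def by (blast intro: computes.Comp)

lemma recursive_in_Suc [recursive_intros]:
  "recursive_in B f \<Longrightarrow> recursive_in B (\<lambda>x. Suc (f x))"
  unfolding recursive_in_def by (blast intro: computes.Comp computes.Succ)

lemma recursive_in_pr1 [recursive_intros]:
  "recursive_in B f \<Longrightarrow> recursive_in B (\<lambda>x. pr1 (f x))"
  unfolding recursive_in_def by (blast intro: computes.Comp computes.Proj1)

lemma recursive_in_pr2 [recursive_intros]:
  "recursive_in B f \<Longrightarrow> recursive_in B (\<lambda>x. pr2 (f x))"
  unfolding recursive_in_def by (blast intro: computes.Comp computes.Proj2)

lemma recursive_in_pair [recursive_intros]: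
  "recursive_in B f \<Longrightarrow> recursive_in B g \<Longrightarrow> recursive_in B (\<lambda>x. prod_encode (f x, g x))"
  unfolding recursive_in_def by (blast intro: computes.Both)

text \<open>
  The base value, the step and the number of iterations may all depend on the parameter \<open>x\<close>;
  \<open>Prec\<close> hands the step a code of \<open>(x, (n, y))\<close>, which explains the projections in the last premise.
\<close>

lemma recursive_in_rec [recursive_intros]:
  assumes "recursive_in B f" and "recursive_in B g"
    and "recursive_in B (\<lambda>z. h (pr1 z) (pr1 (pr2 z)) (pr2 (pr2 z)))"
  shows "recursive_in B (\<lambda>x. rec_nat (f x) (h x) (g x))"
proof -
  obtain p where p: "computes B p x (f x)" for x
    using assms(1) unfolding recursive_in_def by blast
  obtain q where q: "computes B q z (h (pr1 z) (pr1 (pr2 z)) (pr2 (pr2 z)))" for z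
    using assms(3) unfolding recursive_in_def by blast
  have *: "computes B (Prec p q) (prod_encode (x, n)) (rec_nat (f x) (h x) n)" for x n
  proof (induction n)
    case 0
    then show ?case using p by (auto intro: computes.Prec_0)
  next
    case (Suc n)
    show ?case
      using computes.Prec_Suc[OF Suc q] by simp
  qed
  have "recursive_in B (\<lambda>z. rec_nat (f (pr1 z)) (h (pr1 z)) (pr2 z))"
    unfolding recursive_in_def
  proof (intro exI allI)
    fix z
    show "computes B (Prec p q) z (rec_nat (f (pr1 z)) (h (pr1 z)) (pr2 z))"
      using *[of "pr1 z" "pr2 z"] by simp
  qed
  from recursive_in_comp[OF this recursive_in_pair[OF recursive_in_id assms(2)]]
  show ?thesis by simp
qed

lemma recursive_in_funpow:
  assumes "recursive_in B F" and "recursive_in B f" and "recursive_in B g"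
  shows "recursive_in B (\<lambda>x. (F ^^ g x) (f x))"
proof -
  have "(F ^^ n) y = rec_nat y (\<lambda>_ y. F y) n" for n y
    by (induction n) auto
  then show ?thesis
    by (simp, intro recursive_intros assms recursive_in_comp[OF assms(1)])
qed

subsection \<open>Case distinctions, arithmetic and decidable predicates\<close>

lemma recursive_in_if [recursive_intros]:
  assumes "decidable_in B P" and "recursive_in B f" and "recursive_in B g"
  shows "recursive_in B (\<lambda>x. if P x then f x else g x)"
proof -
  have eq: "(\<lambda>x. if P x then f x else g x) = (\<lambda>x. rec_nat (g x) (\<lambda>_ _. f x) (if P x then 1 else 0))"
    by auto
  show ?thesis
    by (subst eq) (intro recursive_intros assms assms(1)[unfolded decidable_in_def]
        recursive_in_comp[OF assms(2)])
qed

lemma recursive_in_pred: "recursive_in B f \<Longrightarrow> recursive_in B (\<lambda>x. f x - 1)"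
proof -
  assume f: "recursive_in B f"
  have "n - 1 = rec_nat 0 (\<lambda>m _. m) n" for n by (cases n) auto
  then show ?thesis by (simp only:) (intro recursive_intros f)
qed

lemma recursive_in_diff [recursive_intros]:
  assumes "recursive_in B f" and "recursive_in B g"
  shows "recursive_in B (\<lambda>x. f x - g x)"
proof -
  have "m - n = rec_nat m (\<lambda>_ y. y - 1) n" for m n by (induction n) auto
  then have eq: "(\<lambda>x. f x - g x) = (\<lambda>x. rec_nat (f x) (\<lambda>_ y. y - 1) (g x))" by blast
  show ?thesis by (subst eq) (intro recursive_intros recursive_in_pred assms)
qed

lemma recursive_in_add [recursive_intros]:
  assumes "recursive_in B f" and "recursive_in B g"
  shows "recursive_in B (\<lambda>x. f x + g x)"
proof -
  have "m + n = rec_nat m (\<lambda>_ y. Suc y) n" for m n by (induction n) auto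
  then show ?thesis by (simp only:) (intro recursive_intros assms)
qed

lemma decidable_in_eq_0:
  assumes "recursive_in B f"
  shows "decidable_in B (\<lambda>x. f x = 0)"
proof -
  have "(\<lambda>x. if f x = 0 then 1 else 0) = (\<lambda>x. rec_nat (1::nat) (\<lambda>_ _. 0) (f x))"
    by (auto simp: fun_eq_iff gr0_conv_Suc)
  then show ?thesis unfolding decidable_in_def
    by (simp only:) (intro recursive_intros assms)
qed

lemma decidable_in_less [recursive_intros]:
  assumes "recursive_in B f" and "recursive_in B g"
  shows "decidable_in B (\<lambda>x. f x < g x)"
proof -
  have "f x < g x \<longleftrightarrow> Suc (f x) - g x = 0" for x by auto
  then show ?thesis by (simp only:) (intro decidable_in_eq_0 recursive_intros assms)
qed

lemma decidable_in_eq [recursive_intros]: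
  assumes "recursive_in B f" and "recursive_in B g"
  shows "decidable_in B (\<lambda>x. f x = g x)"
proof -
  have "f x = g x \<longleftrightarrow> (f x - g x) + (g x - f x) = 0" for x by auto
  then show ?thesis by (simp only:) (intro decidable_in_eq_0 recursive_intros assms)
qed

lemma decidable_in_not [recursive_intros]:
  assumes "decidable_in B P"
  shows "decidable_in B (\<lambda>x. \<not> P x)"
proof -
  have "(\<lambda>x. if \<not> P x then 1 else 0) = (\<lambda>x. if P x then 0 else (1::nat))" by auto
  then show ?thesis unfolding decidable_in_def
    by (simp only:) (intro recursive_intros assms)
qed

lemma decidable_in_conj [recursive_intros]:
  assumes "decidable_in B P" and "decidable_in B Q"
  shows "decidable_in B (\<lambda>x. P x \<and> Q x)"
proof -
  have "(\<lambda>x. if P x \<and> Q x then 1 else 0) = (\<lambda>x. if P x then if Q x then 1 else 0 else (0::nat))"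
    by auto
  then show ?thesis unfolding decidable_in_def
    by (simp only:) (intro recursive_intros assms)
qed

lemma decidable_in_imp [recursive_intros]:
  assumes "decidable_in B P" and "decidable_in B Q"
  shows "decidable_in B (\<lambda>x. P x \<longrightarrow> Q x)"
proof -
  have "(P x \<longrightarrow> Q x) \<longleftrightarrow> \<not> (P x \<and> \<not> Q x)" for x by auto
  then show ?thesis by (simp only:) (intro recursive_intros assms)
qed

lemma decidable_in_iff [recursive_intros]:
  assumes "decidable_in B P" and "decidable_in B Q"
  shows "decidable_in B (\<lambda>x. P x \<longleftrightarrow> Q x)"
proof -
  have "(P x \<longleftrightarrow> Q x) \<longleftrightarrow> (P x \<longrightarrow> Q x) \<and> (Q x \<longrightarrow> P x)" for x by auto
  then show ?thesis by (simp only:) (intro recursive_intros assms)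
qed

lemma decidable_in_comp:
  "decidable_in B P \<Longrightarrow> recursive_in B f \<Longrightarrow> decidable_in B (\<lambda>x. P (f x))"
  unfolding decidable_in_def by (rule recursive_in_comp)

lemma decidable_in_comp2:
  assumes "decidable_in B (\<lambda>z. P (pr1 z) (pr2 z))"
    and "recursive_in B f" and "recursive_in B g"
  shows "decidable_in B (\<lambda>x. P (f x) (g x))"
  using decidable_in_comp[OF assms(1) recursive_in_pair[OF assms(2,3)]] by simp

lemma recursive_in_mod [recursive_intros]:
  assumes "recursive_in B f" and "recursive_in B g"
  shows "recursive_in B (\<lambda>x. f x mod g x)"
proof -
  have "n mod d = rec_nat 0 (\<lambda>_ y. if Suc y = d then 0 else Suc y) n" for n d :: nat
    by (induction n) (auto simp: mod_Suc)
  then show ?thesis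
    by (simp only:) (intro recursive_intros assms recursive_in_comp[OF assms(2)])
qed

lemma recursive_in_div [recursive_intros]:
  assumes "recursive_in B f" and "recursive_in B g"
  shows "recursive_in B (\<lambda>x. f x div g x)"
proof -
  have "n div d = rec_nat 0 (\<lambda>m y. if Suc m mod d = 0 then Suc y else y) n" for n d :: nat
    by (induction n) (auto simp: div_Suc)
  then show ?thesis
    by (simp only:) (intro recursive_intros assms recursive_in_comp[OF assms(2)])
qed

lemma decidable_in_all_less [recursive_intros]:
  assumes "recursive_in B f"
    and "decidable_in B (\<lambda>z. P (pr1 z) (pr2 z))"
  shows "decidable_in B (\<lambda>x. \<forall>n < f x. P x n)"
proof -
  have "(if \<forall>n < N. P x n then 1 else 0) = rec_nat (1::nat) (\<lambda>n y. if P x n then y else 0) N" for x N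
    by (induction N) (auto simp: less_Suc_eq)
  then show ?thesis unfolding decidable_in_def
    by (simp only:) (intro recursive_intros assms decidable_in_comp2[OF assms(2)])
qed

text \<open>Totality of the search is what makes \<open>Mu\<close> halt; \<open>Mu\<close> looks for the value \<open>0\<close>, hence the
  reversed truth values.\<close>

lemma recursive_in_Least:
  assumes "decidable_in B (\<lambda>z. P (pr1 z) (pr2 z))"
    and ex: "\<And>x. \<exists>n. P x n"
  shows "recursive_in B (\<lambda>x. LEAST n. P x n)"
proof -
  have "recursive_in B (\<lambda>z. if P (pr1 z) (pr2 z) then 0 else 1)"
    by (intro recursive_intros assms)
  then obtain p where p: "computes B p z (if P (pr1 z) (pr2 z) then 0 else 1)" for z
    unfolding recursive_in_def by blast
  have "computes B (Mu p) x (LEAST n. P x n)" for x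
  proof (rule computes.Mu)
    show "computes B p (prod_encode (x, LEAST n. P x n)) 0"
      using p[of "prod_encode (x, LEAST n. P x n)"] LeastI_ex[OF ex[of x]] by simp
    show "\<exists>y. computes B p (prod_encode (x, m)) (Suc y)" if "m < (LEAST n. P x n)" for m
      using p[of "prod_encode (x, m)"] not_less_Least[OF that] by auto
  qed
  then show ?thesis unfolding recursive_in_def by blast
qed

subsection \<open>Changing the oracle\<close>

text \<open>
  Transitivity of Turing reducibility on the level of programs: every query to the old oracle
  is replaced by a call of a program that decides it from the new one.
\<close>

primrec subst_query :: "prog \<Rightarrow> prog \<Rightarrow> prog" where
  "subst_query r Zero = Zero"
| "subst_query r Succ = Succ"
| "subst_query r Proj1 = Proj1"
| "subst_query r Proj2 = Proj2"
| "subst_query r Query = r"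
| "subst_query r (Both p q) = Both (subst_query r p) (subst_query r q)"
| "subst_query r (Comp p q) = Comp (subst_query r p) (subst_query r q)"
| "subst_query r (Prec p q) = Prec (subst_query r p) (subst_query r q)"
| "subst_query r (Mu p) = Mu (subst_query r p)"

lemma computes_subst_query:
  assumes "\<And>x. computes B r x (if x \<in> A then 1 else 0)" and "computes A p x y"
  shows "computes B (subst_query r p) x y"
  using assms(2)
proof (induction rule: computes.induct)
  case (Query x)
  then show ?case using assms(1) by simp
next
  case (Mu p a n)
  then show ?case by (auto intro!: computes.Mu)
qed (auto intro: computes.intros)

lemma decidable_in_trans:
  assumes "A \<le>\<^sub>T B" and "decidable_in A P"
  shows "decidable_in B P"
  using assms computes_subst_query
  unfolding decidable_in_def recursive_in_def turing_reducible_def by meson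

lemma decidable_in_oracle: "decidable_in B (\<lambda>x. x \<in> B)"
  unfolding decidable_in_def recursive_in_def using computes.Query by blast

lemma turing_reducible_join: "P \<le>\<^sub>T recursive_join P A" "A \<le>\<^sub>T recursive_join P A"
proof -
  let ?J = "recursive_join P A"
  have "x \<in> P \<longleftrightarrow> x + x \<in> ?J" "x \<in> A \<longleftrightarrow> Suc (x + x) \<in> ?J" for x
    by (auto simp: recursive_join_def simp flip: mult_2; presburger)+
  then show "P \<le>\<^sub>T ?J" "A \<le>\<^sub>T ?J"
    unfolding turing_reducible_iff_decidable_in
    by (simp_all only:) (intro decidable_in_comp[OF decidable_in_oracle] recursive_intros)+
qed

section \<open>A universal machine\<close>

text \<open>
  A program running without oracle is evaluated by a machine with an explicit stack of frames.
  A frame records what remains to be done with the value about to be returned: for instance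
  \<open>Both_Left q x\<close> waits for the left component and then starts \<open>q\<close> on \<open>x\<close>, \<open>Prec_Next q a n\<close> waits
  for the value of the recursion at \<open>n\<close>, and \<open>Mu_Test p a n\<close> waits for the value of \<open>p\<close> at
  \<open>(a, n)\<close>. A single step only inspects the top of the stack, so on codes it is a plain
  case distinction, and the only recursion in a run is the iteration of that step.
\<close>

datatype frame =
    Both_Left prog nat
  | Both_Right nat
  | Comp_Outer prog
  | Prec_Next prog nat nat
  | Mu_Test prog nat nat

datatype config = Eval prog nat "frame list" | Return nat "frame list"

primrec eval_step :: "prog \<Rightarrow> nat \<Rightarrow> frame list \<Rightarrow> config" where
  "eval_step Zero x k = Return 0 k"
| "eval_step Succ x k = Return (Suc x) k"
| "eval_step Proj1 x k = Return (pr1 x) k"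
| "eval_step Proj2 x k = Return (pr2 x) k"
| "eval_step Query x k = Return 0 k"
| "eval_step (Both p q) x k = Eval p x (Both_Left q x # k)"
| "eval_step (Comp p q) x k = Eval q x (Comp_Outer p # k)"
| "eval_step (Prec p q) x k =
    (let a = pr1 x; n = pr2 x in
     if n = 0 then Eval p a k
     else Eval (Prec p q) (prod_encode (a, n - 1)) (Prec_Next q a (n - 1) # k))"
| "eval_step (Mu p) x k = Eval p (prod_encode (x, 0)) (Mu_Test p x 0 # k)"

primrec return_step :: "frame \<Rightarrow> nat \<Rightarrow> frame list \<Rightarrow> config" where
  "return_step (Both_Left q x) y k = Eval q x (Both_Right y # k)"
| "return_step (Both_Right z) y k = Return (prod_encode (z, y)) k"
| "return_step (Comp_Outer p) y k = Eval p y k"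
| "return_step (Prec_Next q a n) y k = Eval q (prod_encode (a, prod_encode (n, y))) k"
| "return_step (Mu_Test p a n) y k =
    (if y = 0 then Return n k
     else Eval p (prod_encode (a, Suc n)) (Mu_Test p a (Suc n) # k))"

text \<open>A returned value under an empty stack is a fixed point, so having halted is preserved by
  further steps.\<close>

fun step :: "config \<Rightarrow> config" where
  "step (Eval p x k) = eval_step p x k"
| "step (Return y []) = Return y []"
| "step (Return y (fr # k)) = return_step fr y k"

subsection \<open>Halting computations are simulated\<close>

inductive reaches :: "config \<Rightarrow> config \<Rightarrow> bool" where
  reaches_refl: "reaches c c"
| reaches_step: "reaches (step c) d \<Longrightarrow> reaches c d"

lemma reaches_Eval: "reaches (eval_step p x k) d \<Longrightarrow> reaches (Eval p x k) d"
  by (rule reaches_step) simp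

lemma reaches_Return: "reaches (return_step fr y k) d \<Longrightarrow> reaches (Return y (fr # k)) d"
  by (rule reaches_step) simp

lemma reaches_trans: "reaches b c \<Longrightarrow> reaches c d \<Longrightarrow> reaches b d"
  by (induction rule: reaches.induct) (auto intro: reaches_step)

lemma reaches_imp_funpow: "reaches c d \<Longrightarrow> \<exists>n. (step ^^ n) c = d"
proof (induction rule: reaches.induct)
  case (reaches_refl c)
  have "(step ^^ 0) c = c" by simp
  then show ?case by blast
next
  case (reaches_step c d)
  then show ?case by (metis funpow_Suc_right o_apply)
qed

text \<open>
  The stack is arbitrary because the induction hypothesis is needed for subprograms, which run
  under additional frames.
\<close>

lemma computes_imp_reaches: "computes {} p x y \<Longrightarrow> reaches (Eval p x k) (Return y k)"
proof (induction arbitrary: k rule: computes.induct)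
  case (Both p x y q z)
  have "reaches (Return z (Both_Right y # k)) (Return (prod_encode (y, z)) k)"
    by (rule reaches_Return) (simp add: reaches_refl)
  with Both.IH(2) have "reaches (Eval q x (Both_Right y # k)) (Return (prod_encode (y, z)) k)"
    by (rule reaches_trans)
  then have "reaches (Return y (Both_Left q x # k)) (Return (prod_encode (y, z)) k)"
    by - (rule reaches_Return, simp)
  with Both.IH(1) have "reaches (Eval p x (Both_Left q x # k)) (Return (prod_encode (y, z)) k)"
    by (rule reaches_trans)
  then show ?case by - (rule reaches_Eval, simp)
next
  case (Comp q x y p z)
  have "reaches (Return y (Comp_Outer p # k)) (Return z k)"
    using Comp.IH(2) by - (rule reaches_Return, simp)
  with Comp.IH(1) have "reaches (Eval q x (Comp_Outer p # k)) (Return z k)"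
    by (rule reaches_trans)
  then show ?case by - (rule reaches_Eval, simp)
next
  case (Prec_0 p a y q)
  then show ?case by - (rule reaches_Eval, simp)
next
  case (Prec_Suc p q a n y z)
  have "reaches (Return y (Prec_Next q a n # k)) (Return z k)"
    using Prec_Suc.IH(2) by - (rule reaches_Return, simp)
  with Prec_Suc.IH(1) have "reaches (Eval (Prec p q) (prod_encode (a, n)) (Prec_Next q a n # k)) (Return z k)"
    by (rule reaches_trans)
  then show ?case by - (rule reaches_Eval, simp)
next
  case (Mu p a n)
  \<comment> \<open>the search passes every candidate up to \<open>n\<close>, since the values below \<open>n\<close> are nonzero\<close>
  have *: "reaches (Eval (Mu p) a k) (Eval p (prod_encode (a, m)) (Mu_Test p a m # k))" if "m \<le> n" for m
    using that
  proof (induction m)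
    case 0
    show ?case by (rule reaches_Eval) (simp add: reaches_refl)
  next
    case (Suc m)
    obtain y where "reaches (Eval p (prod_encode (a, m)) (Mu_Test p a m # k)) (Return (Suc y) (Mu_Test p a m # k))"
      using Mu.IH(2)[of m] Suc.prems by auto
    moreover have "reaches (Return (Suc y) (Mu_Test p a m # k)) (Eval p (prod_encode (a, Suc m)) (Mu_Test p a (Suc m) # k))"
      by (rule reaches_Return) (simp add: reaches_refl)
    ultimately show ?case using Suc.IH Suc.prems by (meson Suc_leD reaches_trans)
  qed
  have "reaches (Return 0 (Mu_Test p a n # k)) (Return n k)"
    by (rule reaches_Return) (simp add: reaches_refl)
  with *[OF order_refl] Mu.IH(1) show ?case by (blast intro: reaches_trans)
qed (rule reaches_Eval, simp add: reaches_refl)+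

subsection \<open>The machine returns only correct outputs\<close>

text \<open>
  Instead of analysing runs by their length, a configuration is given a meaning:
  \<open>unwinds y k z\<close> says that, according to \<open>computes\<close>, handing the value \<open>y\<close> to the stack \<open>k\<close>
  eventually produces \<open>z\<close>, and \<open>yields c z\<close> extends this to configurations. Every step
  preserves the meaning backwards, so the value \<open>z\<close> of a halted configuration is
  already a value that the initial configuration yields.
\<close>

fun unwinds :: "nat \<Rightarrow> frame list \<Rightarrow> nat \<Rightarrow> bool" where
  "unwinds y [] z \<longleftrightarrow> z = y"
| "unwinds y (Both_Left q x # k) z \<longleftrightarrow>
    (\<exists>w. computes {} q x w \<and> unwinds (prod_encode (y, w)) k z)"
| "unwinds y (Both_Right v # k) z \<longleftrightarrow> unwinds (prod_encode (v, y)) k z"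
| "unwinds y (Comp_Outer p # k) z \<longleftrightarrow> (\<exists>w. computes {} p y w \<and> unwinds w k z)"
| "unwinds y (Prec_Next q a n # k) z \<longleftrightarrow>
    (\<exists>w. computes {} q (prod_encode (a, prod_encode (n, y))) w \<and> unwinds w k z)"
| "unwinds y (Mu_Test p a n # k) z \<longleftrightarrow>
    (if y = 0 then unwinds n k z
     else \<exists>m>n. computes {} p (prod_encode (a, m)) 0 \<and>
       (\<forall>i. n < i \<and> i < m \<longrightarrow> (\<exists>w. computes {} p (prod_encode (a, i)) (Suc w))) \<and> unwinds m k z)"

fun yields :: "config \<Rightarrow> nat \<Rightarrow> bool" where
  "yields (Eval p x k) z \<longleftrightarrow> (\<exists>y. computes {} p x y \<and> unwinds y k z)"
| "yields (Return y k) z \<longleftrightarrow> unwinds y k z"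

lemma yields_eval_step:
  assumes "yields (eval_step p x k) z"
  shows "yields (Eval p x k) z"
proof (cases p)
  case (Both p1 p2)
  with assms show ?thesis by (auto intro: computes.Both)
next
  case (Comp p1 p2)
  with assms show ?thesis by (auto intro: computes.Comp)
next
  case (Prec p1 p2)
  obtain a n where x: "x = prod_encode (a, n)" by (metis prod_decode_inverse surj_pair)
  show ?thesis
  proof (cases n)
    case 0
    with assms show ?thesis by (auto simp: Prec x intro: computes.Prec_0)
  next
    case (Suc n')
    with assms show ?thesis by (auto simp: Prec x intro: computes.Prec_Suc)
  qed
next
  case (Mu q)
  from assms obtain w where w: "computes {} q (prod_encode (x, 0)) w" "unwinds w (Mu_Test q x 0 # k) z"
    by (auto simp: Mu)
  show ?thesis
  proof (cases w)
    case 0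
    with w have "computes {} (Mu q) x 0" "unwinds 0 k z" by (auto intro: computes.Mu)
    then show ?thesis unfolding Mu by auto
  next
    case (Suc w')
    with w(2) obtain m where m: "computes {} q (prod_encode (x, m)) 0" "unwinds m k z"
      "\<forall>i. 0 < i \<and> i < m \<longrightarrow> (\<exists>w. computes {} q (prod_encode (x, i)) (Suc w))"
      by auto
    have "\<exists>w. computes {} q (prod_encode (x, i)) (Suc w)" if "i < m" for i
      using m(3) that w(1) Suc by (cases "i = 0") blast+
    with m(1) have "computes {} (Mu q) x m" by (rule computes.Mu)
    with m(2) show ?thesis unfolding Mu by auto
  qed
next
  case Zero
  have "computes {} Zero x 0" by (rule computes.Zero)
  with assms show ?thesis by (auto simp: Zero)
next
  case Succ
  have "computes {} Succ x (Suc x)" by (rule computes.Succ)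
  with assms show ?thesis by (auto simp: Succ)
next
  case Proj1
  have "computes {} Proj1 x (pr1 x)" by (rule computes.Proj1)
  with assms show ?thesis by (auto simp: Proj1)
next
  case Proj2
  have "computes {} Proj2 x (pr2 x)" by (rule computes.Proj2)
  with assms show ?thesis by (auto simp: Proj2)
next
  case Query
  have "computes {} Query x 0" using computes.Query[of "{}" x] by simp
  with assms show ?thesis by (auto simp: Query)
qed

text \<open>
  The only frame with work to do is \<open>Mu_Test\<close>: when the value at \<open>n\<close> is nonzero, the meaning for
  the next candidate \<open>Suc n\<close> is a search starting one further, and the value at \<open>Suc n\<close> either ends
  the search or fills the gap between the two ranges.
\<close>

lemma unwinds_return_step:
  assumes "yields (return_step fr y k) z"
  shows "unwinds y (fr # k) z"
proof (cases fr)
  case (Mu_Test p a n)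
  show ?thesis
  proof (cases "y = 0")
    case True
    with assms show ?thesis by (simp add: Mu_Test)
  next
    case False
    with assms obtain w where w: "computes {} p (prod_encode (a, Suc n)) w"
      "unwinds w (Mu_Test p a (Suc n) # k) z"
      by (auto simp: Mu_Test)
    show ?thesis
    proof (cases w)
      case 0
      with w False show ?thesis
        unfolding Mu_Test by (auto intro!: exI[of _ "Suc n"])
    next
      case (Suc w')
      with w(2) obtain m where m: "m > Suc n" "computes {} p (prod_encode (a, m)) 0" "unwinds m k z"
        "\<forall>i. Suc n < i \<and> i < m \<longrightarrow> (\<exists>w. computes {} p (prod_encode (a, i)) (Suc w))"
        by auto
      have "\<exists>w. computes {} p (prod_encode (a, i)) (Suc w)" if "n < i" "i < m" for i
        using m(4) that w(1) Suc by (cases "i = Suc n") (blast, metis Suc_lessI)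
      then have "\<forall>i. n < i \<and> i < m \<longrightarrow> (\<exists>w. computes {} p (prod_encode (a, i)) (Suc w))"
        by blast
      moreover have "n < m" using m(1) by simp
      ultimately show ?thesis using m(2,3) False unfolding Mu_Test unwinds.simps by metis
    qed
  qed
qed (use assms in simp_all)

lemma yields_step: "yields (step c) z \<Longrightarrow> yields c z"
  using yields_eval_step unwinds_return_step
  by (cases c rule: step.cases) auto

lemma yields_funpow: "yields ((step ^^ n) c) z \<Longrightarrow> yields c z"
  by (induction n) (auto intro: yields_step)

subsection \<open>Halting within a number of steps\<close>

definition halts_by :: "prog \<Rightarrow> nat \<Rightarrow> nat \<Rightarrow> bool" where
  "halts_by p x s \<longleftrightarrow> (\<exists>y. (step ^^ s) (Eval p x []) = Return y [])"

lemma halts_by_mono: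
  assumes "halts_by p x s" and "s \<le> t"
  shows "halts_by p x t"
proof -
  obtain y where y: "(step ^^ s) (Eval p x []) = Return y []"
    using assms(1) unfolding halts_by_def by blast
  have "(step ^^ r) (Return y []) = Return y []" for r
    by (induction r) auto
  moreover have "(step ^^ t) (Eval p x []) = (step ^^ (t - s)) ((step ^^ s) (Eval p x []))"
    using assms(2) by (metis funpow_add le_add_diff_inverse2 o_apply)
  ultimately show ?thesis unfolding halts_by_def y by auto
qed

text \<open>This makes the domain of every program the union of a uniformly decidable increasing family
  of stages.\<close>

lemma ex_halts_by_iff: "(\<exists>s. halts_by p x s) \<longleftrightarrow> (\<exists>y. computes {} p x y)"
proof
  assume "\<exists>s. halts_by p x s"
  then obtain s y where "(step ^^ s) (Eval p x []) = Return y []"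
    unfolding halts_by_def by blast
  then have "yields ((step ^^ s) (Eval p x [])) y" by simp
  then have "yields (Eval p x []) y" by (rule yields_funpow)
  then show "\<exists>y. computes {} p x y" by auto
next
  assume "\<exists>y. computes {} p x y"
  then show "\<exists>s. halts_by p x s"
    unfolding halts_by_def using computes_imp_reaches reaches_imp_funpow by blast
qed

subsection \<open>Running the machine is recursive\<close>

abbreviation eval_code :: "nat \<Rightarrow> nat \<Rightarrow> nat \<Rightarrow> nat" where
  "eval_code e x k \<equiv> prod_encode (0, prod_encode (e, prod_encode (x, k)))"

abbreviation return_code :: "nat \<Rightarrow> nat \<Rightarrow> nat" where
  "return_code y k \<equiv> prod_encode (1, prod_encode (y, k))"

abbreviation push :: "nat \<Rightarrow> nat \<Rightarrow> nat" where
  "push fr k \<equiv> Suc (prod_encode (fr, k))"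

primrec frame_code :: "frame \<Rightarrow> nat" where
  "frame_code (Both_Left q x) = prod_encode (0, prod_encode (prog_code q, x))"
| "frame_code (Both_Right y) = prod_encode (1, y)"
| "frame_code (Comp_Outer p) = prod_encode (2, prog_code p)"
| "frame_code (Prec_Next q a n) = prod_encode (3, prod_encode (prog_code q, prod_encode (a, n)))"
| "frame_code (Mu_Test p a n) = prod_encode (4, prod_encode (prog_code p, prod_encode (a, n)))"

abbreviation stack_code :: "frame list \<Rightarrow> nat" where
  "stack_code k \<equiv> list_encode (map frame_code k)"

primrec config_code :: "config \<Rightarrow> nat" where
  "config_code (Eval p x k) = eval_code (prog_code p) x (stack_code k)"
| "config_code (Return y k) = return_code y (stack_code k)"

text \<open>
  The composite programs are the codes \<open>e = 4 * c + 5 + r\<close> with \<open>r < 4\<close>; the remainder \<open>r\<close> of \<open>e - 5\<close>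
  tells the constructor and the quotient \<open>c\<close> codes its arguments.
\<close>

definition eval_step_code :: "nat \<Rightarrow> nat \<Rightarrow> nat \<Rightarrow> nat" where
  "eval_step_code e x k =
    (if e = 0 then return_code 0 k
     else if e = 1 then return_code (Suc x) k
     else if e = 2 then return_code (pr1 x) k
     else if e = 3 then return_code (pr2 x) k
     else if e = 4 then return_code 0 k
     else if (e - 5) mod 4 = 0 then
       eval_code (pr1 ((e - 5) div 4)) x
         (push (prod_encode (0, prod_encode (pr2 ((e - 5) div 4), x))) k)
     else if (e - 5) mod 4 = 1 then
       eval_code (pr2 ((e - 5) div 4)) x
         (push (prod_encode (2, pr1 ((e - 5) div 4))) k)
     else if (e - 5) mod 4 = 2 then
       if pr2 x = 0 then
         eval_code (pr1 ((e - 5) div 4)) (pr1 x) k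
       else
         eval_code e (prod_encode (pr1 x, pr2 x - 1))
           (push (prod_encode (3, prod_encode (pr2 ((e - 5) div 4),
              prod_encode (pr1 x, pr2 x - 1)))) k)
     else
       eval_code ((e - 5) div 4) (prod_encode (x, 0))
         (push (prod_encode (4, prod_encode ((e - 5) div 4, prod_encode (x, 0)))) k))"

lemma eval_step_code_eq:
  "eval_step_code (prog_code p) x (stack_code k) = config_code (eval_step p x k)"
proof -
  have diff: "4 * c + 6 - 5 = 4 * c + (1::nat)" "4 * c + 7 - 5 = 4 * c + (2::nat)"
    "4 * c + 8 - 5 = 4 * c + (3::nat)" for c
    by simp_all
  have div_mod: "Suc (4 * c) div 4 = c" "Suc (Suc (4 * c)) div 4 = c"
    "Suc (Suc (Suc (4 * c))) div 4 = c"
    "Suc (4 * c) mod 4 = 1" "Suc (Suc (4 * c)) mod 4 = 2"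
    "Suc (Suc (Suc (4 * c))) mod 4 = 3" for c :: nat
    by presburger+
  show ?thesis
  proof (cases p)
    case (Both p1 p2)
    then show ?thesis by (simp add: eval_step_code_def)
  next
    case (Comp p1 p2)
    then show ?thesis by (simp add: eval_step_code_def diff div_mod)
  next
    case (Prec p1 p2)
    then show ?thesis by (simp add: eval_step_code_def diff div_mod Let_def)
  next
    case (Mu q)
    then show ?thesis by (simp add: eval_step_code_def diff div_mod)
  qed (simp_all add: eval_step_code_def)
qed

lemma recursive_in_eval_step_code [recursive_intros]:
  assumes "recursive_in B e" and "recursive_in B x" and "recursive_in B k"
  shows "recursive_in B (\<lambda>z. eval_step_code (e z) (x z) (k z))"
  unfolding eval_step_code_def by (intro recursive_intros assms)

text \<open>The arguments are the tag and the data of the top frame, the returned value, and the rest of the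
  stack.\<close>

definition return_step_code :: "nat \<Rightarrow> nat \<Rightarrow> nat \<Rightarrow> nat \<Rightarrow> nat" where
  "return_step_code t d y k =
    (if t = 0 then eval_code (pr1 d) (pr2 d) (push (prod_encode (1, y)) k)
     else if t = 1 then return_code (prod_encode (d, y)) k
     else if t = 2 then eval_code d y k
     else if t = 3 then
       eval_code (pr1 d) (prod_encode (pr1 (pr2 d), prod_encode (pr2 (pr2 d), y))) k
     else if y = 0 then return_code (pr2 (pr2 d)) k
     else
       eval_code (pr1 d) (prod_encode (pr1 (pr2 d), Suc (pr2 (pr2 d))))
         (push (prod_encode (4, prod_encode (pr1 d,
           prod_encode (pr1 (pr2 d), Suc (pr2 (pr2 d)))))) k))"

lemma return_step_code_eq:
  "return_step_code (pr1 (frame_code fr)) (pr2 (frame_code fr)) y (stack_code k)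
    = config_code (return_step fr y k)"
  by (cases fr) (simp_all add: return_step_code_def)

lemma recursive_in_return_step_code [recursive_intros]:
  assumes "recursive_in B t" and "recursive_in B d" and "recursive_in B y" and "recursive_in B k"
  shows "recursive_in B (\<lambda>z. return_step_code (t z) (d z) (y z) (k z))"
  unfolding return_step_code_def by (intro recursive_intros assms)

text \<open>
  Nonempty stacks are successors of pairs of a frame and the remaining stack, which accounts for
  the predecessors; the code \<open>0\<close> is the empty stack.
\<close>

definition step_code :: "nat \<Rightarrow> nat" where
  "step_code c =
    (if pr1 c = 0 then eval_step_code (pr1 (pr2 c)) (pr1 (pr2 (pr2 c))) (pr2 (pr2 (pr2 c)))
     else if pr2 (pr2 c) = 0 then c
     else
       return_step_code (pr1 (pr1 (pr2 (pr2 c) - 1))) (pr2 (pr1 (pr2 (pr2 c) - 1)))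
         (pr1 (pr2 c)) (pr2 (pr2 (pr2 c) - 1)))"

lemma step_code_eq: "step_code (config_code c) = config_code (step c)"
  by (cases c rule: step.cases)
    (simp_all add: step_code_def eval_step_code_eq return_step_code_eq)

lemma recursive_in_step_code: "recursive_in B step_code"
  unfolding step_code_def by (intro recursive_intros)

lemma funpow_step_code: "(step_code ^^ s) (config_code c) = config_code ((step ^^ s) c)"
  by (induction s) (simp_all add: step_code_eq)

text \<open>
  The program occurs only through its index, which may itself depend on the input. This
  uniformity is what a universal machine is for.
\<close>

lemma decidable_in_halts_by [recursive_intros]:
  assumes "recursive_in B e" and "recursive_in B x" and "recursive_in B s"
  shows "decidable_in B (\<lambda>z. halts_by (inv prog_code (e z)) (x z) (s z))"
proof -
  have halted: "(\<exists>y. c = Return y []) \<longleftrightarrow>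
      pr1 (config_code c) = 1 \<and> pr2 (pr2 (config_code c)) = 0" for c
    by (cases c rule: step.cases) auto
  have code: "config_code (Eval (inv prog_code e) x []) = eval_code e x 0" for e x
    by (simp add: bij_is_surj[OF bij_prog_code] surj_f_inv_f)
  show ?thesis
    unfolding halts_by_def halted funpow_step_code[symmetric] code
    by (intro recursive_intros recursive_in_funpow[OF recursive_in_step_code] assms)
qed

section \<open>Sets of PA degree separate disjoint r.e. sets\<close>

text \<open>
  The list operations needed to decide membership in a tree of coded strings come from
  iterating the tail: codes of empty lists are \<open>0\<close> and stay \<open>0\<close>, since \<open>0\<close> codes the pair \<open>(0, 0)\<close>.
\<close>

definition drop_code :: "nat \<Rightarrow> nat \<Rightarrow> nat" where
  "drop_code k c = rec_nat c (\<lambda>_ d. pr2 (d - 1)) k"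

lemma drop_code: "drop_code k (list_encode l) = list_encode (drop k l)"
proof (induction k)
  case 0
  then show ?case by (simp add: drop_code_def)
next
  case (Suc k)
  have "pr2 0 = 0"
    using prod_encode_inverse[of "(0, 0)"] by (simp add: prod_encode_def)
  then have tl: "pr2 (list_encode l' - 1) = list_encode (tl l')" for l'
    by (cases l') simp_all
  have "drop_code (Suc k) (list_encode l) = pr2 (drop_code k (list_encode l) - 1)"
    by (simp add: drop_code_def)
  then show ?case by (simp only: Suc tl tl_drop drop_Suc)
qed

lemma recursive_in_drop_code [recursive_intros]:
  assumes "recursive_in B f" and "recursive_in B g"
  shows "recursive_in B (\<lambda>x. drop_code (f x) (g x))"
  unfolding drop_code_def by (intro recursive_intros assms)

text \<open>The code itself is a bound for quantifiers over the positions of a coded list.\<close>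

lemma length_le_list_encode: "length l \<le> list_encode l"
proof (induction l)
  case (Cons x l)
  then show ?case using le_prod_encode_2[of "list_encode l" x] by simp
qed simp

lemma drop_code_neq_0: "drop_code k (list_encode l) \<noteq> 0 \<longleftrightarrow> k < length l"
proof -
  have "list_encode m \<noteq> 0 \<longleftrightarrow> m \<noteq> []" for m by (cases m) simp_all
  then show ?thesis by (simp add: drop_code not_le)
qed

text \<open>
  The projections \<open>{i. \<exists>u. R i u}\<close> and \<open>{i. \<exists>u. S i u}\<close> of decidable relations are the general r.e.
  sets. A string stays in the tree as long as it respects those memberships that are witnessed by
  a stage below its length; this is decidable and closed under prefixes, and a path is
  eventually tested against every witness.
\<close>

lemma pi01_class_separators:
  assumes "decidable_in {} (\<lambda>z. R (pr1 z) (pr2 z))"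
    and "decidable_in {} (\<lambda>z. S (pr1 z) (pr2 z))"
  shows "pi01_class {X. \<forall>i u. (R i u \<longrightarrow> i \<in> X) \<and> (S i u \<longrightarrow> i \<notin> X)}"
proof -
  define T where "T = {s. \<forall>i < length s. \<forall>u < length s. (R i u \<longrightarrow> s ! i) \<and> (S i u \<longrightarrow> \<not> s ! i)}"
  have "binary_tree T"
    unfolding binary_tree_def
  proof (intro ballI allI impI)
    fix s t assume s: "s \<in> T" and "prefix t s"
    then obtain r where r: "s = t @ r" by (auto simp: prefix_def)
    have "(R i u \<longrightarrow> t ! i) \<and> (S i u \<longrightarrow> \<not> t ! i)" if "i < length t" "u < length t" for i u
    proof -
      have "i < length s" "u < length s" "s ! i = t ! i" using that by (simp_all add: r nth_append)
      with s show ?thesis unfolding T_def by auto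
    qed
    then show "t \<in> T" unfolding T_def by blast
  qed
  moreover have "paths T = {X. \<forall>i u. (R i u \<longrightarrow> i \<in> X) \<and> (S i u \<longrightarrow> i \<notin> X)}" (is "_ = ?C")
  proof (intro set_eqI iffI)
    fix X assume X: "X \<in> paths T"
    have "(R i u \<longrightarrow> i \<in> X) \<and> (S i u \<longrightarrow> i \<notin> X)" for i u
    proof -
      have "initial_segment X (Suc (max i u)) \<in> T" using X unfolding paths_def by blast
      moreover have "i < Suc (max i u)" "u < Suc (max i u)" by auto
      ultimately show ?thesis
        unfolding T_def initial_segment_def by (simp del: upt_Suc)
    qed
    then show "X \<in> ?C" by blast
  next
    fix X assume "X \<in> ?C"
    then show "X \<in> paths T" unfolding paths_def T_def initial_segment_def by simp
  qed
  moreover have "computable (string_code ` T)"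
  proof -
    \<comment> \<open>the tree in terms of codes: all entries are truth values, and positions and stages alike
      range over the indices of the list, recognised by a nonzero remainder\<close>
    define nth_code where "nth_code k c = pr1 (drop_code k c - 1)" for k c
    have nth_code: "nth_code k (list_encode l) = l ! k" if "k < length l" for k l
    proof -
      have "drop k l = l ! k # drop (Suc k) l" using that by (simp add: Cons_nth_drop_Suc)
      then show ?thesis by (simp add: nth_code_def drop_code)
    qed
    have "c \<in> string_code ` T \<longleftrightarrow>
      (\<forall>k < c. drop_code k c \<noteq> 0 \<longrightarrow> nth_code k c < 2 \<and>
        (\<forall>u < c. drop_code u c \<noteq> 0 \<longrightarrow>
          (R k u \<longrightarrow> nth_code k c = 1) \<and> (S k u \<longrightarrow> nth_code k c = 0)))" (is "_ \<longleftrightarrow> ?D c") for c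
    proof -
      define l where "l = list_decode c"
      have c: "c = list_encode l" by (simp add: l_def)
      have bounded: "(\<forall>k < list_encode l. k < length l \<longrightarrow> Q k) \<longleftrightarrow> (\<forall>k < length l. Q k)" for Q
        using length_le_list_encode[of l] by (meson less_le_trans)
      have D: "?D c \<longleftrightarrow> (\<forall>k < length l. l ! k < 2 \<and>
          (\<forall>u < length l. (R k u \<longrightarrow> l ! k = 1) \<and> (S k u \<longrightarrow> l ! k = 0)))"
        unfolding c drop_code_neq_0 bounded by (simp add: nth_code)
      show ?thesis
      proof
        assume "c \<in> string_code ` T"
        then obtain s where s: "s \<in> T" "l = map of_bool s"
          by (auto simp: string_code_def l_def)
        then show "?D c" unfolding D T_def by simp
      next
        assume "?D c"
        then have l: "\<forall>k < length l. l ! k < 2 \<and>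
          (\<forall>u < length l. (R k u \<longrightarrow> l ! k = 1) \<and> (S k u \<longrightarrow> l ! k = 0))"
          unfolding D .
        define s where "s = map (\<lambda>b. b = 1) l"
        have "map of_bool s = l"
          using l unfolding s_def by (auto intro!: nth_equalityI simp: less_2_cases_iff)
        then have "c = string_code s" by (simp add: string_code_def c)
        moreover have "s \<in> T" using l unfolding T_def s_def by auto
        ultimately show "c \<in> string_code ` T" by blast
      qed
    qed
    then show ?thesis
      unfolding computable_def turing_reducible_iff_decidable_in nth_code_def
      by (simp only:) (intro recursive_intros decidable_in_comp2[OF assms(1)] decidable_in_comp2[OF assms(2)])
  qed
  ultimately show ?thesis unfolding pi01_class_def by blast
qed

lemma PA_degree_separates:
  assumes "PA_degree P"
    and R: "decidable_in {} (\<lambda>z. R (pr1 z) (pr2 z))"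
    and S: "decidable_in {} (\<lambda>z. S (pr1 z) (pr2 z))"
    and disjoint: "\<And>i u v. \<not> (R i u \<and> S i v)"
  shows "\<exists>X. X \<le>\<^sub>T P \<and> (\<forall>i u. (R i u \<longrightarrow> i \<in> X) \<and> (S i u \<longrightarrow> i \<notin> X))"
proof -
  define C where "C = {X. \<forall>i u. (R i u \<longrightarrow> i \<in> X) \<and> (S i u \<longrightarrow> i \<notin> X)}"
  have "pi01_class C"
    unfolding C_def using R S by (rule pi01_class_separators)
  moreover have "{i. \<exists>u. R i u} \<in> C"
    using disjoint by (auto simp: C_def)
  then have "C \<noteq> {}" by auto
  ultimately obtain X where "X \<in> C" "X \<le>\<^sub>T P"
    using assms(1) unfolding PA_degree_def by auto
  then show ?thesis by (auto simp: C_def)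
qed

section \<open>Joining a set of PA degree with an r.e. set\<close>

theorem corollary2p1:
  fixes A P :: "nat set"
  assumes "recursively_enumerable A"
    and "PA_degree P"
    and "\<not> A \<le>\<^sub>T P"
  shows "halting_problem \<le>\<^sub>T recursive_join P A"
proof -
  from assms(1) obtain p where "A = {x. \<exists>y. computes {} p x y}"
    unfolding recursively_enumerable_def by blast
  moreover define a where "a = prog_code p"
  moreover have "inv prog_code a = p"
    unfolding a_def by (simp add: bij_is_inj[OF bij_prog_code])
  ultimately have A: "n \<in> A \<longleftrightarrow> (\<exists>s. halts_by (inv prog_code a) n s)" for n
    by (simp add: ex_halts_by_iff)
  have K: "e \<in> halting_problem \<longleftrightarrow> (\<exists>s. halts_by (inv prog_code e) e s)" for e
    by (simp add: halting_problem_def turing_jump_def ex_halts_by_iff)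
  define K_at where "K_at i u \<longleftrightarrow> halts_by (inv prog_code (pr1 i)) (pr1 i) u" for i u
  define A_at where "A_at i u \<longleftrightarrow> halts_by (inv prog_code a) (pr2 i) u" for i u
  \<comment> \<open>if \<open>u \<le> v\<close> then \<open>A_at i u\<close> persists to \<open>v\<close>, and if \<open>v \<le> u\<close> then \<open>K_at i v\<close> persists to \<open>u\<close>\<close>
  have "\<not> ((A_at i u \<and> \<not> K_at i u) \<and> (K_at i v \<and> \<not> A_at i v))" for i u v
    using halts_by_mono nat_le_linear unfolding K_at_def A_at_def by blast
  moreover have "decidable_in {} (\<lambda>z. A_at (pr1 z) (pr2 z) \<and> \<not> K_at (pr1 z) (pr2 z))"
    "decidable_in {} (\<lambda>z. K_at (pr1 z) (pr2 z) \<and> \<not> A_at (pr1 z) (pr2 z))"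
    unfolding K_at_def A_at_def by (intro recursive_intros)+
  \<comment> \<open>nothing is required of pairs whose two events fall on the same stage: there \<open>e\<close> is in the
      halting problem and \<open>n\<close> is in \<open>A\<close>, so that the equivalence \<open>correct\<close> holds anyway\<close>
  ultimately obtain X where X: "X \<le>\<^sub>T P"
    and A_first: "\<And>i u. A_at i u \<Longrightarrow> \<not> K_at i u \<Longrightarrow> i \<in> X"
    and K_first: "\<And>i u. K_at i u \<Longrightarrow> \<not> A_at i u \<Longrightarrow> i \<notin> X"
    using PA_degree_separates[OF assms(2), of "\<lambda>i u. A_at i u \<and> \<not> K_at i u"
        "\<lambda>i u. K_at i u \<and> \<not> A_at i u"] by auto
  let ?differ = "\<lambda>e n. (prod_encode (e, n) \<in> X) \<noteq> (n \<in> A)"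
  have correct: "e \<in> halting_problem \<longleftrightarrow> n \<in> A" if "?differ e n" for e n
  proof
    assume "e \<in> halting_problem"
    then obtain u where u: "K_at (prod_encode (e, n)) u" unfolding K K_at_def by auto
    show "n \<in> A"
    proof (rule ccontr)
      assume "n \<notin> A"
      then have "\<not> A_at (prod_encode (e, n)) u" unfolding A A_at_def by auto
      with u K_first have "prod_encode (e, n) \<notin> X" by blast
      with that \<open>n \<notin> A\<close> show False by blast
    qed
  next
    assume "n \<in> A"
    then obtain u where u: "A_at (prod_encode (e, n)) u" unfolding A A_at_def by auto
    show "e \<in> halting_problem"
    proof (rule ccontr)
      assume "e \<notin> halting_problem"
      then have "\<not> K_at (prod_encode (e, n)) u" unfolding K K_at_def by auto
      with u A_first have "prod_encode (e, n) \<in> X" by blast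
      with that \<open>n \<in> A\<close> show False by blast
    qed
  qed
  have ex: "\<exists>n. ?differ e n" for e
  proof (rule ccontr)
    assume "\<nexists>n. ?differ e n"
    then have "n \<in> A \<longleftrightarrow> prod_encode (e, n) \<in> X" for n by blast
    moreover have "decidable_in P (\<lambda>n. prod_encode (e, n) \<in> X)"
      using X unfolding turing_reducible_iff_decidable_in
      by (rule decidable_in_comp) (intro recursive_intros)
    ultimately have "A \<le>\<^sub>T P" by (simp add: turing_reducible_iff_decidable_in)
    with assms(3) show False ..
  qed
  let ?J = "recursive_join P A"
  have X_J: "decidable_in ?J (\<lambda>i. i \<in> X)"
    using X turing_reducible_join(1) unfolding turing_reducible_iff_decidable_in[of X]
    by (blast intro: decidable_in_trans)
  have A_J: "decidable_in ?J (\<lambda>n. n \<in> A)"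
    using turing_reducible_join(2) unfolding turing_reducible_iff_decidable_in .
  have "recursive_in ?J (\<lambda>e. LEAST n. ?differ e n)"
    by (intro recursive_in_Least recursive_intros decidable_in_comp[OF X_J] decidable_in_comp[OF A_J] ex)
  then have "decidable_in ?J (\<lambda>e. (LEAST n. ?differ e n) \<in> A)"
    by (rule decidable_in_comp[OF A_J])
  moreover have "e \<in> halting_problem \<longleftrightarrow> (LEAST n. ?differ e n) \<in> A" for e
    by (rule correct[OF LeastI_ex[OF ex]])
  ultimately show ?thesis
    unfolding turing_reducible_iff_decidable_in by simp
qed

end
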